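(* Let $S\subseteq\mathbb{R}^2$ be a finite set of points in general linear position, and let $V_2^2:\mathbb{R}^2\to\mathbb{R}^5$, $V_2^2(x,y)=(x^2,xy,y^2,x,y)$, be the degree $2$ Veronese map of the plane. Then the image $V_2^2(S)$ is neighborly.
   Context: A set of at least $d+1$ points in $\mathbb{R}^d$ is in general linear position if no $d+1$ (and thus no fewer) of its points are affinely dependent. A polytope is $k$-neighborly if any set of $k$ or fewer of its vertices forms a face (is the vertex set of a face, the polytope itself being counted as a face). A polytope of dimension $d$ is neighborly if it is $\lfloor d/2\rfloor$-neighborly. A finite point set is $k$-neighborly (respectively neighborly) if it is the vertex set of a $k$-neighborly (respectively neighborly) polytope. *)

theory Defs
  imports "HOL-Analysis.Analysis"
begin

definition general_linear_position :: "'a::euclidean_space set \<Rightarrow> bool" where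
  "general_linear_position S \<longleftrightarrow>
     (infinite S \<or> DIM('a) + 1 \<le> card S) \<and>
     (\<forall>T\<subseteq>S. card T = DIM('a) + 1 \<longrightarrow> \<not> affine_dependent T)"

definition vertices :: "'a::euclidean_space set \<Rightarrow> 'a set" where
  "vertices P = {v. v extreme_point_of P}"

text \<open>Both the empty set and the polytope itself are faces in the sense of \<open>face_of\<close>.\<close>

definition k_neighborly_polytope :: "nat \<Rightarrow> 'a::euclidean_space set \<Rightarrow> bool" where
  "k_neighborly_polytope k P \<longleftrightarrow> polytope P \<and>
     (\<forall>T\<subseteq>vertices P. card T \<le> k \<longrightarrow> (\<exists>F. F face_of P \<and> vertices F = T))"

text \<open>The dimension is that of the polytope itself, which may be smaller than that of the
  ambient space. It is \<open>-1\<close> for the empty polytope, whence the truncation by \<open>nat\<close>.\<close>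

definition neighborly_polytope :: "'a::euclidean_space set \<Rightarrow> bool" where
  "neighborly_polytope P \<longleftrightarrow> k_neighborly_polytope (nat \<lfloor>real_of_int (aff_dim P) / 2\<rfloor>) P"

definition neighborly_set :: "'a::euclidean_space set \<Rightarrow> bool" where
  "neighborly_set S \<longleftrightarrow> finite S \<and> (\<exists>P. neighborly_polytope P \<and> vertices P = S)"

definition veronese :: "real^2 \<Rightarrow> real^5" where
  "veronese p = vector [(p $ 1)\<^sup>2, p $ 1 * p $ 2, (p $ 2)\<^sup>2, p $ 1, p $ 2]"

lemma veronese_nth:
  "veronese p $ 1 = (p $ 1)\<^sup>2"
  "veronese p $ 2 = p $ 1 * p $ 2"
  "veronese p $ 3 = (p $ 2)\<^sup>2"
  "veronese p $ 4 = p $ 1"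
  "veronese p $ 5 = p $ 2"
  by (simp_all add: veronese_def vector_def)

end

theory Submission
  imports Defs
begin

text \<open>A quadratic polynomial on the plane is an affine functional of the Veronese image. The square
  of the equation of the line through two points of \<open>S\<close> is nonnegative and, by general position,
  vanishes on \<open>S\<close> at these two points only; hence it exposes the corresponding edge. Squared distances
  expose the single points. Neighborliness asks for nothing more, as the ambient dimension is 5.\<close>

lemma vertices_convex_hull_subset: "vertices (convex hull T) \<subseteq> T"
  by (auto simp: vertices_def extreme_point_of_convex_hull)

text \<open>The functional given by \<open>a\<close> is constant on the affine hull of
  \<open>T\<close> and strictly larger on the convex hull of the other points. So these two hulls
  are disjoint, which for finite \<open>X\<close> suffices for a face.\<close>

lemma exposed_face_of_convex_hull:
  fixes X :: "'a::euclidean_space set"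
  assumes "finite X" "T \<subseteq> X"
    and eq: "\<And>y. y \<in> T \<Longrightarrow> a \<bullet> y = b"
    and gt: "\<And>y. y \<in> X - T \<Longrightarrow> a \<bullet> y > b"
  shows "convex hull T face_of convex hull X"
proof -
  have "affine hull T \<subseteq> {y. a \<bullet> y = b}"
    using eq by (intro hull_minimal) (auto simp: affine_hyperplane)
  moreover have "convex hull (X - T) \<subseteq> {y. a \<bullet> y > b}"
    using gt by (intro hull_minimal) (auto simp: convex_halfspace_gt)
  ultimately have "affine hull T \<inter> convex hull (X - T) = {}"
    by fastforce
  then show ?thesis
    using assms by (intro face_of_convex_hulls)
qed

lemma inj_veronese: "inj veronese"
proof (rule injI)
  fix p q assume "veronese p = veronese q"
  then have "p$1 = q$1" "p$2 = q$2"
    by (metis veronese_nth(4), metis veronese_nth(5))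
  then show "p = q"
    by (simp add: vec_eq_iff forall_2)
qed

lemma sum_5: "sum f (UNIV::5 set) = f 1 + f 2 + f 3 + f 4 + f 5"
proof -
  have UNIV: "(UNIV::5 set) = {1, 2, 3, 4, 5}"
    by (rule sym, rule card_subset_eq) simp_all
  show ?thesis
    unfolding UNIV by (simp add: add.assoc)
qed

lemma inner_veronese:
  "vector [A, B, C, D, E] \<bullet> veronese p =
     A * (p$1)\<^sup>2 + B * (p$1 * p$2) + C * (p$2)\<^sup>2 + D * p$1 + E * p$2"
proof -
  have "vector [A, B, C, D, E] $ (1::5) = A" "vector [A, B, C, D, E] $ (2::5) = B"
    "vector [A, B, C, D, E] $ (3::5) = C" "vector [A, B, C, D, E] $ (4::5) = D"
    "vector [A, B, C, D, E] $ (5::5) = E"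
    by (simp_all add: vector_def)
  then show ?thesis
    unfolding inner_vec_def sum_5 veronese_nth by (simp only: inner_real_def)
qed

lemma quadratic_face:
  fixes S T :: "(real^2) set"
  assumes "finite S" "T \<subseteq> S"
    and q: "\<And>p. q p = A * (p$1)\<^sup>2 + B * (p$1 * p$2) + C * (p$2)\<^sup>2 + D * p$1 + E * p$2 + G"
    and "\<And>p. p \<in> T \<Longrightarrow> q p = 0"
    and "\<And>p. p \<in> S - T \<Longrightarrow> q p > 0"
  shows "convex hull (veronese ` T) face_of convex hull (veronese ` S)"
proof (rule exposed_face_of_convex_hull)
  \<comment> \<open>The Veronese map has no constant coordinate, so the constant term
    \<open>G\<close> turns into the offset \<open>- G\<close> of the supporting hyperplane.\<close>
  have *: "vector [A, B, C, D, E] \<bullet> veronese p = q p - G" for p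
    by (simp add: q inner_veronese)
  show "vector [A, B, C, D, E] \<bullet> y = - G" if "y \<in> veronese ` T" for y
    using that assms(4) by (auto simp: *)
  show "vector [A, B, C, D, E] \<bullet> y > - G" if y: "y \<in> veronese ` S - veronese ` T" for y
  proof -
    obtain p where "p \<in> S - T" "y = veronese p"
      using y by blast
    then show ?thesis
      using assms(5)[of p] by (simp add: *)
  qed
qed (use assms in auto)

lemma veronese_singleton_face:
  assumes "finite S" "p \<in> S"
  shows "convex hull (veronese ` {p}) face_of convex hull (veronese ` S)"
proof (rule quadratic_face[where q = "\<lambda>x. (x$1 - p$1)\<^sup>2 + (x$2 - p$2)\<^sup>2"])
  show "(x$1 - p$1)\<^sup>2 + (x$2 - p$2)\<^sup>2 = 1 * (x$1)\<^sup>2 + 0 * (x$1 * x$2) + 1 * (x$2)\<^sup>2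
      + (- 2 * p$1) * x$1 + (- 2 * p$2) * x$2 + ((p$1)\<^sup>2 + (p$2)\<^sup>2)" for x
    by (simp add: power2_eq_square algebra_simps)
  show "(x$1 - p$1)\<^sup>2 + (x$2 - p$2)\<^sup>2 > 0" if "x \<in> S - {p}" for x
  proof -
    have "x$1 \<noteq> p$1 \<or> x$2 \<noteq> p$2"
      using that by (auto simp: vec_eq_iff forall_2)
    then show ?thesis
      by (simp add: sum_power2_gt_zero_iff)
  qed
qed (use assms in auto)

text \<open>The equation says that the determinant of \<open>q - p\<close> and \<open>r - p\<close>
  vanishes. Since \<open>q - p\<close> is nonzero, \<open>r - p\<close> is a multiple of it.\<close>

lemma line_equation_imp_affine_hull:
  fixes p q r :: "real^2"
  assumes "p \<noteq> q" and eq: "(q$2 - p$2) * (r$1 - p$1) = (q$1 - p$1) * (r$2 - p$2)"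
  shows "r \<in> affine hull {p, q}"
proof -
  \<comment> \<open>The ratio \<open>t\<close> is read off from a coordinate in which
    \<open>p\<close> and \<open>q\<close> differ.\<close>
  obtain t where t: "r$1 - p$1 = t * (q$1 - p$1)" "r$2 - p$2 = t * (q$2 - p$2)"
  proof (cases "q$1 = p$1")
    case True
    then have "q$2 \<noteq> p$2"
      using assms(1) by (auto simp: vec_eq_iff forall_2)
    with True eq show ?thesis
      by (intro that[of "(r$2 - p$2) / (q$2 - p$2)"]) auto
  next
    case False
    with eq show ?thesis
      by (intro that[of "(r$1 - p$1) / (q$1 - p$1)"]) (auto simp: field_simps)
  qed
  have "r = (1 - t) *\<^sub>R p + t *\<^sub>R q"
    using t by (simp add: vec_eq_iff forall_2 algebra_simps)
  then show ?thesis
    unfolding affine_hull_2 by force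
qed

lemma veronese_pair_face:
  fixes S :: "(real^2) set"
  assumes "finite S" "general_linear_position S" "p \<in> S" "q \<in> S" "p \<noteq> q"
  shows "convex hull (veronese ` {p, q}) face_of convex hull (veronese ` S)"
proof -
  \<comment> \<open>The vector \<open>(d, -e)\<close> is normal to the line through \<open>p\<close>
    and \<open>q\<close>, and \<open>c\<close> is the value of \<open>d * x$1 - e * x$2\<close> on
    that line.\<close>
  define d e where "d = q$2 - p$2" and "e = q$1 - p$1"
  define c where "c = d * p$1 - e * p$2"
  show ?thesis
  proof (rule quadratic_face[where q = "\<lambda>x. (d * (x$1 - p$1) - e * (x$2 - p$2))\<^sup>2"])
    show "(d * (x$1 - p$1) - e * (x$2 - p$2))\<^sup>2 = d\<^sup>2 * (x$1)\<^sup>2 + (- 2 * d * e) * (x$1 * x$2)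
        + e\<^sup>2 * (x$2)\<^sup>2 + (- 2 * c * d) * x$1 + (2 * c * e) * x$2 + c\<^sup>2" for x
      by (simp add: c_def power2_eq_square algebra_simps)
    show "(d * (x$1 - p$1) - e * (x$2 - p$2))\<^sup>2 = 0" if "x \<in> {p, q}" for x
      using that by (auto simp: d_def e_def)
    show "(d * (r$1 - p$1) - e * (r$2 - p$2))\<^sup>2 > 0" if r: "r \<in> S - {p, q}" for r
    proof -
      have "card {r, p, q} = DIM(real^2) + 1"
        using r assms by auto
      then have "\<not> affine_dependent {r, p, q}"
        using assms(2-4) r unfolding general_linear_position_def
        by (metis Diff_iff empty_subsetI insert_subset)
      moreover have "{r, p, q} - {r} = {p, q}"
        using r by auto
      ultimately have "r \<notin> affine hull {p, q}"
        unfolding affine_dependent_def by (metis insertI1)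
      then have "d * (r$1 - p$1) - e * (r$2 - p$2) \<noteq> 0"
        using line_equation_imp_affine_hull[OF \<open>p \<noteq> q\<close>, of r] by (auto simp: d_def e_def)
      then show ?thesis
        by simp
    qed
  qed (use assms in auto)
qed

theorem theorem3p4:
  fixes S :: "(real^2) set"
  assumes "finite S" and "general_linear_position S"
  shows "neighborly_set (veronese ` S)"
proof -
  let ?P = "convex hull (veronese ` S)"
  \<comment> \<open>One-point faces correspond to extreme points, so no image point is lost as a
    vertex.\<close>
  have "v \<in> vertices ?P" if "v \<in> veronese ` S" for v
    using that veronese_singleton_face[OF assms(1)]
    by (auto simp: vertices_def face_of_singleton)
  then have vert: "vertices ?P = veronese ` S"
    using vertices_convex_hull_subset by blast
  have "\<exists>F. F face_of ?P \<and> vertices F = T"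
    if T: "T \<subseteq> vertices ?P" and card: "card T \<le> 2" for T
  proof -
    obtain U where U: "U \<subseteq> S" "T = veronese ` U"
      using T vert by (auto simp: subset_image_iff)
    \<comment> \<open>As \<open>card\<close> is 0 on infinite sets too, finiteness is what makes the
      case \<open>card U = 0\<close> the empty face.\<close>
    have "finite U"
      using U assms(1) finite_subset by blast
    \<comment> \<open>Injectivity carries the bound from \<open>T\<close> back to the plane;
      otherwise many points could share an image.\<close>
    have "card U \<le> 2"
      using card U inj_veronese by (metis card_image inj_on_subset subset_UNIV)
    then consider "card U = 0" | "card U = 1" | "card U = 2"
      by linarith
    then have face: "convex hull T face_of ?P"
    proof cases
      case 1
      then show ?thesis
        using U \<open>finite U\<close> by simp
    next
      case 2
      then obtain p where "U = {p}"
        using card_1_singletonE by blast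
      then show ?thesis
        using U veronese_singleton_face[OF assms(1)] by simp
    next
      case 3
      then obtain p q where "U = {p, q}" "p \<noteq> q"
        by (auto simp: card_2_iff)
      then show ?thesis
        using U veronese_pair_face[OF assms, of p q] by simp
    qed
    \<comment> \<open>The extreme points of a face are the extreme points of the whole polytope that
      lie in it.\<close>
    moreover have "T \<subseteq> vertices (convex hull T)"
      using T hull_subset[of T convex] extreme_point_of_face[OF face]
      by (auto simp: vertices_def)
    ultimately show ?thesis
      using vertices_convex_hull_subset by blast
  qed
  \<comment> \<open>The polytope may have dimension below 5, but the required order never exceeds 2,
    the integer part of 5/2.\<close>
  moreover have "nat \<lfloor>real_of_int (aff_dim ?P) / 2\<rfloor> \<le> 2"
    using aff_dim_le_DIM[of ?P] by simp linarith
  moreover have "polytope ?P"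
    using assms(1) by (simp add: polytope_convex_hull)
  ultimately have "neighborly_polytope ?P"
    unfolding neighborly_polytope_def k_neighborly_polytope_def by (meson order_trans)
  with vert assms(1) show ?thesis
    unfolding neighborly_set_def by blast
qed

end
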